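(* Let $V$ be a non-empty finite set, let $\mu$ be a probability measure on $V^V$, and let $\lambda\in\mathcal P(V)$ be $\mu$-invariant, i.e. $\lambda=\mu*\lambda$. Then there exists $\Lambda\in\mathcal P(V^{m_\mu}_\times)$ such that $\Lambda$ is $\mu$-invariant (i.e. $\Lambda=\mu*\Lambda$) and its marginal in the first coordinate equals $\lambda$, i.e. $$\Lambda\{(x^1,\dots,x^{m_\mu})\in V^{m_\mu}_\times:x^1=v\}=\lambda\{v\},\qquad v\in V.$$
   Context: $V^V$ is the finite semigroup of maps $V\to V$ under composition; $f\in V^V$ acts componentwise on $V^m$: $f(x^1,\dots,x^m)=(fx^1,\dots,fx^m)$. $\mathcal P(A)$ is the set of probability measures on a finite set $A$. $V^m_\times$ is the set of $(x^1,\dots,x^m)\in V^m$ with distinct entries; a measure on $V^m_\times$ is regarded as a measure on $V^m$. For $\mu\in\mathcal P(V^V)$ and $\Lambda\in\mathcal P(V^m)$, $\mu*\Lambda\in\mathcal P(V^m)$ is defined by $(\mu*\Lambda)(A)=\sum_{f\in V^V}\sum_{\mathbf x\in V^m}1_A(f\mathbf x)\,\mu\{f\}\,\Lambda\{\mathbf x\}$ (with $m=1$ for $\mu*\lambda$). $S=\bigcup_{n\ge1}\mathcal S(\mu)^n$ is the semigroup generated by the support $\mathcal S(\mu)$ of $\mu$, and $m_\mu=\min\{\#(fV):f\in S\}$. *)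

theory Defs
  imports "HOL-Probability.Probability"
begin

text \<open>
  The non-empty finite set \<open>V\<close> is the type \<open>'v::finite\<close>, so \<open>V\<^sup>V\<close> is the finite type
  \<open>'v \<Rightarrow> 'v\<close>, and probability measures on finite sets are \<open>pmf\<close>s. Since the length of the
  tuples considered depends on a measure, \<open>V\<^sup>m\<close> is represented by the lists of length \<open>m\<close>
  (the coordinate \<open>x\<^sup>i\<close> being \<open>xs ! (i - 1)\<close>), on which \<open>f\<close> acts componentwise by
  \<open>map f\<close>; a measure on a set \<open>A\<close> of tuples is a \<open>pmf\<close> on lists whose support lies in \<open>A\<close>.
\<close>

definition tuples :: "nat \<Rightarrow> 'v list set" where
  "tuples m = {xs. length xs = m}"

definition distinct_tuples :: "nat \<Rightarrow> 'v list set" where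
  "distinct_tuples m = {xs \<in> tuples m. distinct xs}"

definition prob_measures_on :: "'a set \<Rightarrow> 'a pmf set" where
  "prob_measures_on A = {p. set_pmf p \<subseteq> A}"

text \<open>
  \<open>\<mu> * \<lambda>\<close> for measures on \<open>V\<close> and on tuples: the law of \<open>f x\<close> for independent \<open>f\<close> and \<open>x\<close>.
  The lemmas below give the defining sums.
\<close>

definition conv :: "('v \<Rightarrow> 'v) pmf \<Rightarrow> 'v pmf \<Rightarrow> 'v pmf" where
  "conv \<mu> lam = bind_pmf \<mu> (\<lambda>f. map_pmf f lam)"

definition conv_tuples :: "('v \<Rightarrow> 'v) pmf \<Rightarrow> 'v list pmf \<Rightarrow> 'v list pmf" where
  "conv_tuples \<mu> \<Lambda> = bind_pmf \<mu> (\<lambda>f. map_pmf (map f) \<Lambda>)"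

lemma prob_bind_map_pmf:
  fixes \<mu> :: "'f::finite pmf"
  assumes "finite T" "set_pmf p \<subseteq> T"
  shows "measure_pmf.prob (bind_pmf \<mu> (\<lambda>f. map_pmf (a f) p)) A =
    (\<Sum>f\<in>UNIV. \<Sum>x\<in>T. indicator A (a f x) * pmf \<mu> f * pmf p x)"
proof -
  have "bind_pmf \<mu> (\<lambda>f. map_pmf (a f) p) = map_pmf (\<lambda>(f, x). a f x) (pair_pmf \<mu> p)"
    by (simp add: pair_pmf_def map_bind_pmf map_pmf_def bind_assoc_pmf bind_return_pmf)
  then have "measure_pmf.prob (bind_pmf \<mu> (\<lambda>f. map_pmf (a f) p)) A =
    (\<integral>z. indicator ((\<lambda>(f, x). a f x) -` A) z \<partial>measure_pmf (pair_pmf \<mu> p))"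
    by simp
  also have "\<dots> = (\<Sum>z\<in>UNIV \<times> T. indicator ((\<lambda>(f, x). a f x) -` A) z * pmf (pair_pmf \<mu> p) z)"
    using assms by (intro integral_measure_pmf_real) auto
  also have "\<dots> = (\<Sum>f\<in>UNIV. \<Sum>x\<in>T. indicator A (a f x) * pmf \<mu> f * pmf p x)"
    by (subst sum.cartesian_product, rule sum.cong)
       (auto simp: pmf_pair indicator_def split: prod.splits)
  finally show ?thesis .
qed

lemma prob_conv:
  fixes \<mu> :: "('v::finite \<Rightarrow> 'v) pmf"
  shows "measure_pmf.prob (conv \<mu> lam) A =
    (\<Sum>f\<in>UNIV. \<Sum>x\<in>UNIV. indicator A (f x) * pmf \<mu> f * pmf lam x)"
  unfolding conv_def by (intro prob_bind_map_pmf) auto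

lemma conv_tuples_on:
  assumes "\<Lambda> \<in> prob_measures_on (tuples m)"
  shows "conv_tuples \<mu> \<Lambda> \<in> prob_measures_on (tuples m)"
  using assms by (auto simp: conv_tuples_def prob_measures_on_def tuples_def)

lemma prob_conv_tuples:
  fixes \<mu> :: "('v::finite \<Rightarrow> 'v) pmf"
  assumes "\<Lambda> \<in> prob_measures_on (tuples m)"
  shows "measure_pmf.prob (conv_tuples \<mu> \<Lambda>) A =
    (\<Sum>f\<in>UNIV. \<Sum>xs\<in>tuples m. indicator A (map f xs) * pmf \<mu> f * pmf \<Lambda> xs)"
  unfolding conv_tuples_def
  using assms finite_lists_length_eq[of "UNIV :: 'v set" m]
  by (intro prob_bind_map_pmf) (auto simp: prob_measures_on_def tuples_def)

text \<open>\<open>comp_power F n\<close> is the set \<open>F\<^sup>n\<close> of all compositions of \<open>n\<close> elements of \<open>F\<close>.\<close>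

primrec comp_power :: "('v \<Rightarrow> 'v) set \<Rightarrow> nat \<Rightarrow> ('v \<Rightarrow> 'v) set" where
  "comp_power F 0 = {id}"
| "comp_power F (Suc n) = {f \<circ> g | f g. f \<in> F \<and> g \<in> comp_power F n}"

definition generated_semigroup :: "('v \<Rightarrow> 'v) pmf \<Rightarrow> ('v \<Rightarrow> 'v) set" where
  "generated_semigroup \<mu> = (\<Union>n\<in>{1..}. comp_power (set_pmf \<mu>) n)"

definition min_rank :: "('v::finite \<Rightarrow> 'v) pmf \<Rightarrow> nat" where
  "min_rank \<mu> = Min ((\<lambda>f. card (range f)) ` generated_semigroup \<mu>)"

end

theory Submission
  imports Defs
begin

text \<open>
  The images of the elements of minimal rank in the semigroup are never collapsed further, so
  the set \<open>T\<close> of their enumerations is a set of distinct tuples that is closed under the support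
  of \<open>\<mu>\<close>. The union of these images is closed too and can be reached from every point; by
  recurrence it carries \<open>\<lambda>\<close>. Hence some measure on \<open>T\<close> has first marginal \<open>\<lambda>\<close>, and a limit point
  of the Cesaro averages of its images under the powers of \<open>\<mu>\<close> is invariant, with the same
  first marginal.
\<close>

section \<open>Compactness and Cesaro limits of measures on a finite set\<close>

text \<open>Bolzano-Weierstrass at one point at a time: each new point costs a further subsequence,
  which keeps the limits already obtained.\<close>

lemma finite_pointwise_convergent_subseq:
  fixes f :: "nat \<Rightarrow> 'a \<Rightarrow> real"
  assumes "finite T" "\<And>x. x \<in> T \<Longrightarrow> Bseq (\<lambda>n. f n x)"
  shows "\<exists>r L. strict_mono (r :: nat \<Rightarrow> nat) \<and> (\<forall>x\<in>T. (\<lambda>n. f (r n) x) \<longlonglongrightarrow> L x)"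
  using assms
proof (induction T rule: finite_induct)
  case empty
  show ?case using strict_mono_id by blast
next
  case (insert a T)
  then obtain r L where r: "strict_mono (r :: nat \<Rightarrow> nat)"
    and L: "\<And>x. x \<in> T \<Longrightarrow> (\<lambda>n. f (r n) x) \<longlonglongrightarrow> L x" by auto
  have "bounded (range (\<lambda>n. f (r n) a))"
    using Bseq_subseq[OF insert.prems[of a], of r] by (simp add: Bseq_eq_bounded)
  then obtain l s where s: "strict_mono (s :: nat \<Rightarrow> nat)" and l: "(\<lambda>n. f (r (s n)) a) \<longlonglongrightarrow> l"
    using bounded_imp_convergent_subsequence[of "\<lambda>n. f (r n) a"] by (auto simp: o_def)
  have "(\<lambda>n. f (r (s n)) x) \<longlonglongrightarrow> (L(a := l)) x" if "x \<in> insert a T" for x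
    using that insert.hyps l LIMSEQ_subseq_LIMSEQ[OF L s] by (auto simp: o_def)
  with strict_mono_o[OF r s] show ?case
    by (intro exI[of _ "r \<circ> s"] exI[of _ "L(a := l)"]) (auto simp: o_def)
qed

text \<open>Krylov-Bogoliubov argument: shifting a Cesaro average by one step changes it by a
  vanishing amount, so any limit point is fixed by the kernel \<open>K\<close>. The last conclusion
  later preserves the first marginal.\<close>

lemma cesaro_limit_pmf:
  fixes q :: "nat \<Rightarrow> 'a pmf" and K :: "'a \<Rightarrow> 'a pmf"
  assumes fin: "finite T" and q_T: "\<And>n. set_pmf (q n) \<subseteq> T"
    and step: "\<And>n. q (Suc n) = bind_pmf (q n) K"
  obtains p where "set_pmf p \<subseteq> T" "p = bind_pmf p K"
    "\<And>A c. (\<And>n. measure_pmf.prob (q n) A = c) \<Longrightarrow> measure_pmf.prob p A = c"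
proof -
  \<comment> \<open>Averaging over \<open>Suc N\<close> terms makes \<open>avg\<close> of a constant
    that constant for every \<open>N\<close>, including 0.\<close>
  define avg where "avg = (\<lambda>u :: nat \<Rightarrow> real. \<lambda>N. (\<Sum>n<Suc N. u n) / real (Suc N))"
  have avg_const: "avg (\<lambda>_. c) = (\<lambda>_. c)" for c
    by (auto simp: avg_def fun_eq_iff simp del: sum.lessThan_Suc of_nat_Suc)
  have avg_sum: "avg (\<lambda>n. \<Sum>x\<in>B. c x * u n x) N = (\<Sum>x\<in>B. c x * avg (\<lambda>n. u n x) N)"
    for B c u N
    unfolding avg_def
    by (subst sum.swap)
      (simp add: sum_divide_distrib sum_distrib_left del: sum.lessThan_Suc of_nat_Suc)
  have avg_01: "0 \<le> avg (\<lambda>n. pmf (q n) x) N" "avg (\<lambda>n. pmf (q n) x) N \<le> 1" for x N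
    using sum_bounded_above[of "{..<Suc N}" "\<lambda>n. pmf (q n) x" 1]
    by (auto simp: avg_def pmf_le_1 intro!: sum_nonneg divide_nonneg_nonneg
        simp del: sum.lessThan_Suc of_nat_Suc)
  have "Bseq (\<lambda>N. avg (\<lambda>n. pmf (q n) x) N)" for x
    by (rule BseqI'[of _ 1]) (use avg_01 in auto)
  then obtain r L where r: "strict_mono (r :: nat \<Rightarrow> nat)"
    and L: "\<And>x. x \<in> T \<Longrightarrow> (\<lambda>N. avg (\<lambda>n. pmf (q n) x) (r N)) \<longlonglongrightarrow> L x"
    using finite_pointwise_convergent_subseq[OF fin, of "\<lambda>N x. avg (\<lambda>n. pmf (q n) x) N"] by blast
  have L_nonneg: "0 \<le> L x" if "x \<in> T" for x
    using LIMSEQ_le_const[OF L[OF that]] avg_01 by blast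
  have L_sum: "(\<lambda>N. avg (\<lambda>n. \<Sum>x\<in>B. c x * pmf (q n) x) (r N)) \<longlonglongrightarrow> (\<Sum>x\<in>B. c x * L x)"
    if "B \<subseteq> T" for B c
    unfolding avg_sum using that by (intro tendsto_sum tendsto_mult_left L) auto
  have prob_q: "measure_pmf.prob (q n) A = (\<Sum>x\<in>A \<inter> T. 1 * pmf (q n) x)" for n A
  proof -
    have "measure_pmf.prob (q n) A = measure_pmf.prob (q n) (A \<inter> T)"
      using q_T by (intro measure_pmf.finite_measure_eq_AE) (auto simp: AE_measure_pmf_iff)
    then show ?thesis using fin by (simp add: measure_measure_pmf_finite)
  qed
  have L_prob: "(\<Sum>x\<in>A \<inter> T. L x) = c" if "\<And>n. measure_pmf.prob (q n) A = c" for A c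
    using L_sum[of "A \<inter> T" "\<lambda>_. 1"] that
    unfolding prob_q[symmetric] by (simp add: avg_const LIMSEQ_const_iff)
  \<comment> \<open>\<open>L\<close> is controlled only on \<open>T\<close>; the density must vanish
    elsewhere.\<close>
  define L' where "L' x = (if x \<in> T then L x else 0)" for x
  define p where "p = embed_pmf L'"
  have "(\<integral>\<^sup>+x. ennreal (L' x) \<partial>count_space UNIV) = (\<Sum>x\<in>T. ennreal (L' x))"
    using fin by (intro nn_integral_count_space') (auto simp: L'_def)
  also have "\<dots> = ennreal (\<Sum>x\<in>T. L x)"
    using L_nonneg by (subst sum_ennreal) (auto simp: L'_def)
  \<comment> \<open>The sure event has probability 1 under every \<open>q n\<close>, so no mass is
    lost in the limit.\<close>
  also have "\<dots> = 1"
    using L_prob[of UNIV 1] by simp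
  finally have pmf_p: "pmf p x = L' x" for x
    unfolding p_def by (intro pmf_embed_pmf) (auto simp: L'_def L_nonneg)
  have p_T: "set_pmf p \<subseteq> T"
    by (auto simp: set_pmf_iff pmf_p L'_def split: if_splits)
  have pmf_bind_T: "pmf (bind_pmf p' K) y = (\<Sum>x\<in>T. pmf (K x) y * pmf p' x)"
    if "set_pmf p' \<subseteq> T" for p' y
    unfolding pmf_bind using fin that by (intro integral_measure_pmf_real) auto
  have "pmf p y = pmf (bind_pmf p K) y" for y
  proof -
    \<comment> \<open>The difference of the two sums telescopes to its end terms, which stay bounded
      while the denominator grows.\<close>
    have shift: "avg (\<lambda>n. pmf (q (Suc n)) y) N - avg (\<lambda>n. pmf (q n) y) N
        = (pmf (q (Suc N)) y - pmf (q 0) y) / real (Suc N)" for N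
      unfolding avg_def diff_divide_distrib[symmetric] sum_subtractf[symmetric]
      by (subst sum_lessThan_telescope[of "\<lambda>n. pmf (q n) y"]) (rule refl)
    have "(\<lambda>N. avg (\<lambda>n. pmf (q (Suc n)) y) N - avg (\<lambda>n. pmf (q n) y) N) \<longlonglongrightarrow> 0"
    proof (rule tendsto_rabs_zero_cancel, rule tendsto_sandwich[OF _ _ tendsto_const lim_inverse_n'])
      \<comment> \<open>\<open>N = 0\<close> is left out, since \<open>1 / real 0\<close> is
        0.\<close>
      show "\<forall>\<^sub>F N in sequentially.
          \<bar>avg (\<lambda>n. pmf (q (Suc n)) y) N - avg (\<lambda>n. pmf (q n) y) N\<bar> \<le> 1 / real N"
        unfolding shift using eventually_gt_at_top[of 0]
      proof eventually_elim
        case (elim N)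
        have "\<bar>pmf (q (Suc N)) y - pmf (q 0) y\<bar> \<le> 1"
          using pmf_nonneg[of "q (Suc N)" y] pmf_nonneg[of "q 0" y]
            pmf_le_1[of "q (Suc N)" y] pmf_le_1[of "q 0" y] by linarith
        with elim show ?case unfolding abs_divide by (intro frac_le) auto
      qed
    qed auto
    then have diff: "(\<lambda>N. avg (\<lambda>n. pmf (q (Suc n)) y) (r N) - avg (\<lambda>n. pmf (q n) y) (r N)) \<longlonglongrightarrow> 0"
      using LIMSEQ_subseq_LIMSEQ[OF _ r] by (fastforce simp: o_def)
    \<comment> \<open>Applying \<open>K\<close> is a finite linear combination of point masses on
      \<open>T\<close>, so it commutes with averages and limits.\<close>
    have bind: "(\<lambda>N. avg (\<lambda>n. pmf (q (Suc n)) y) (r N)) \<longlonglongrightarrow> pmf (bind_pmf p K) y"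
      using L_sum[of T "\<lambda>x. pmf (K x) y"]
      by (simp add: step pmf_bind_T q_T p_T pmf_p L'_def)
    have "(\<lambda>N. avg (\<lambda>n. pmf (q n) y) (r N)) \<longlonglongrightarrow> pmf p y"
    proof (cases "y \<in> T")
      case True
      then show ?thesis using L by (simp add: pmf_p L'_def)
    next
      case False
      then have "pmf (q n) y = 0" for n
        using q_T by (auto simp: pmf_eq_0_set_pmf)
      with False show ?thesis by (simp add: avg_const pmf_p L'_def)
    qed
    from LIMSEQ_unique[OF tendsto_diff[OF bind this] diff] show ?thesis by simp
  qed
  then have "p = bind_pmf p K"
    by (rule pmf_eqI)
  moreover have "measure_pmf.prob p A = c" if "\<And>n. measure_pmf.prob (q n) A = c" for A c
  proof -
    have "measure_pmf.prob p A = measure_pmf.prob p (A \<inter> T)"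
      using p_T by (intro measure_pmf.finite_measure_eq_AE) (auto simp: AE_measure_pmf_iff)
    also have "\<dots> = (\<Sum>x\<in>A \<inter> T. L x)"
      using fin by (simp add: measure_measure_pmf_finite pmf_p L'_def)
    finally show ?thesis using L_prob[OF that] by simp
  qed
  ultimately show thesis using that p_T by blast
qed

section \<open>Invariant measures and closed sets\<close>

text \<open>By invariance the mass of \<open>W\<close> is the \<mu>-average of the masses of its
  preimages. Closedness makes each of these, for maps in the support, at least the mass of
  \<open>W\<close>, so all are equal to it, and no charged point can enter \<open>W\<close> from
  outside.\<close>

lemma invariant_pmf_no_entrance:
  fixes \<mu> :: "('v::finite \<Rightarrow> 'v) pmf"
  assumes inv: "lam = conv \<mu> lam"
    and closed: "\<And>f x. f \<in> set_pmf \<mu> \<Longrightarrow> x \<in> W \<Longrightarrow> f x \<in> W"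
    and f: "f \<in> set_pmf \<mu>" and x: "x \<in> set_pmf lam" "x \<notin> W"
  shows "f x \<in> set_pmf lam" "f x \<notin> W"
proof -
  have "f x \<in> set_pmf (conv \<mu> lam)"
    using f x by (auto simp: conv_def)
  with inv show "f x \<in> set_pmf lam" by simp
  \<comment> \<open>The weighted gain of mass under \<open>g\<close>: nonnegative terms whose sum
    will be zero.\<close>
  define d where "d g = pmf \<mu> g * (measure_pmf.prob lam (g -` W) - measure_pmf.prob lam W)" for g
  have d_nonneg: "0 \<le> d g" for g
  proof (cases "g \<in> set_pmf \<mu>")
    case True
    then have "measure_pmf.prob lam W \<le> measure_pmf.prob lam (g -` W)"
      using closed by (intro measure_pmf.finite_measure_mono) auto
    then show ?thesis by (simp add: d_def)
  qed (simp add: d_def set_pmf_iff)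
  have "measure_pmf.prob lam W = (\<Sum>g\<in>UNIV. pmf \<mu> g * measure_pmf.prob lam (g -` W))"
    by (subst inv, unfold prob_conv, rule sum.cong[OF refl])
      (auto simp: measure_measure_pmf_finite sum_distrib_left
        intro!: sum.mono_neutral_cong_right)
  moreover have "(\<Sum>g\<in>UNIV. pmf \<mu> g) = 1"
    by (rule sum_pmf_eq_1) auto
  ultimately have "(\<Sum>g\<in>UNIV. d g) = 0"
    by (simp add: d_def right_diff_distrib sum_subtractf sum_distrib_right[symmetric])
  then have "d f = 0"
    using d_nonneg by (simp add: sum_nonneg_eq_0_iff)
  then have eq: "measure_pmf.prob lam (f -` W) = measure_pmf.prob lam W"
    using f by (simp add: d_def set_pmf_iff)
  show "f x \<notin> W"
  proof
    assume "f x \<in> W"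
    \<comment> \<open>An entering point \<open>x\<close> would add its own positive mass to the
      preimage of \<open>W\<close>.\<close>
    have "measure_pmf.prob lam (insert x W) \<le> measure_pmf.prob lam (f -` W)"
      using closed f \<open>f x \<in> W\<close> by (intro measure_pmf.finite_measure_mono) auto
    moreover have "measure_pmf.prob lam (insert x W) = pmf lam x + measure_pmf.prob lam W"
      using x by (simp add: measure_measure_pmf_finite)
    ultimately show False
      using eq x pmf_positive[of x lam] by simp
  qed
qed

text \<open>A charged point outside \<open>W\<close> would stay outside under every composition of
  maps from the support, but \<open>g\<close> sends every point into \<open>W\<close>.\<close>

lemma invariant_pmf_support_subset:
  fixes \<mu> :: "('v::finite \<Rightarrow> 'v) pmf"
  assumes inv: "lam = conv \<mu> lam"
    and closed: "\<And>f x. f \<in> set_pmf \<mu> \<Longrightarrow> x \<in> W \<Longrightarrow> f x \<in> W"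
    and g: "g \<in> generated_semigroup \<mu>" "range g \<subseteq> W"
  shows "set_pmf lam \<subseteq> W"
proof
  fix x assume x: "x \<in> set_pmf lam"
  have "h x \<in> set_pmf lam - W" if "h \<in> comp_power (set_pmf \<mu>) n" "x \<notin> W" for h n
    using that
  proof (induction n arbitrary: h)
    case (Suc n)
    then obtain f k where "h = f \<circ> k" "f \<in> set_pmf \<mu>" "k x \<in> set_pmf lam - W" by auto
    then show ?case using invariant_pmf_no_entrance[of lam \<mu> W f "k x"] inv closed by auto
  qed (simp add: x)
  with g show "x \<in> W" by (auto simp: generated_semigroup_def)
qed

section \<open>Convolution on tuples and maps of minimal rank\<close>

text \<open>Drawing the tuple before the map exhibits the convolution as one step of a Markov
  kernel, the form used by \<open>cesaro_limit_pmf\<close>.\<close>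

lemma conv_tuples_eq_bind:
  "conv_tuples \<mu> \<Lambda> = bind_pmf \<Lambda> (\<lambda>xs. map_pmf (\<lambda>f. map f xs) \<mu>)"
  unfolding conv_tuples_def map_pmf_def by (rule bind_commute_pmf)

lemma marginal_conv_tuples:
  assumes "\<And>xs. xs \<in> set_pmf \<Lambda> \<Longrightarrow> i < length xs"
  shows "map_pmf (\<lambda>xs. xs ! i) (conv_tuples \<mu> \<Lambda>) = conv \<mu> (map_pmf (\<lambda>xs. xs ! i) \<Lambda>)"
  unfolding conv_tuples_def conv_def map_bind_pmf pmf.map_comp
  using assms by (intro bind_pmf_cong pmf.map_cong) auto

lemma min_rank_le: "g \<in> generated_semigroup \<mu> \<Longrightarrow> min_rank \<mu> \<le> card (range g)"
  by (simp add: min_rank_def)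

lemma obtain_min_rank:
  obtains g where "g \<in> generated_semigroup \<mu>" "card (range g) = min_rank \<mu>"
proof -
  obtain f where "f \<in> set_pmf \<mu>"
    using set_pmf_not_empty[of \<mu>] by blast
  then have "f \<in> comp_power (set_pmf \<mu>) 1" by force
  then have "generated_semigroup \<mu> \<noteq> {}"
    unfolding generated_semigroup_def by force
  then have "min_rank \<mu> \<in> (\<lambda>f. card (range f)) ` generated_semigroup \<mu>"
    unfolding min_rank_def by (intro Min_in) auto
  with that show thesis by force
qed

lemma comp_generated_semigroup:
  assumes "f \<in> set_pmf \<mu>" "g \<in> generated_semigroup \<mu>"
  shows "f \<circ> g \<in> generated_semigroup \<mu>"
proof -
  from assms(2) obtain n where "g \<in> comp_power (set_pmf \<mu>) n"
    by (auto simp: generated_semigroup_def)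
  with assms(1) have "f \<circ> g \<in> comp_power (set_pmf \<mu>) (Suc n)" by auto
  then show ?thesis unfolding generated_semigroup_def by (rule UN_I[rotated]) simp
qed

text \<open>The image of \<open>f \<circ> g\<close> is the image of \<open>range g\<close> under
  \<open>f\<close>, hence no larger than \<open>range g\<close>; minimality forbids it to be
  smaller, and equal finite cardinalities force injectivity.\<close>

lemma comp_min_rank:
  assumes f: "f \<in> set_pmf \<mu>" and g: "g \<in> generated_semigroup \<mu>" "card (range g) = min_rank \<mu>"
  shows "card (range (f \<circ> g)) = min_rank \<mu>" "inj_on f (range g)"
proof -
  have "min_rank \<mu> \<le> card (f ` range g)"
    using min_rank_le[OF comp_generated_semigroup[OF f g(1)]] by (simp add: image_comp)
  then have "card (f ` range g) = card (range g)"
    using card_image_le[of "range g" f] g(2) by simp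
  then show "card (range (f \<circ> g)) = min_rank \<mu>" "inj_on f (range g)"
    using g(2) by (auto simp: image_comp intro: eq_card_imp_inj_on)
qed

section \<open>Construction of the invariant measure on tuples\<close>

theorem corollary1p14:
  fixes \<mu> :: "('v::finite \<Rightarrow> 'v) pmf" and lam :: "'v pmf"
  assumes "lam = conv \<mu> lam"
  shows "\<exists>\<Lambda> \<in> prob_measures_on (distinct_tuples (min_rank \<mu>)).
           \<Lambda> = conv_tuples \<mu> \<Lambda> \<and>
           (\<forall>v. measure_pmf.prob \<Lambda> {xs \<in> distinct_tuples (min_rank \<mu>). xs ! 0 = v} = pmf lam v)"
proof -
  define m where "m = min_rank \<mu>"
  define G where "G = {g \<in> generated_semigroup \<mu>. card (range g) = m}"
  define T where "T = {xs. distinct xs \<and> (\<exists>g\<in>G. set xs = range g)}"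
  have G_step: "f \<circ> g \<in> G" "inj_on f (range g)" if "f \<in> set_pmf \<mu>" "g \<in> G" for f g
    using that comp_min_rank[of f \<mu> g] comp_generated_semigroup[of f \<mu> g]
    by (auto simp: G_def m_def)
  have T_step: "map f xs \<in> T" if "f \<in> set_pmf \<mu>" "xs \<in> T" for f xs
  proof -
    obtain g where "g \<in> G" "set xs = range g" using \<open>xs \<in> T\<close> by (auto simp: T_def)
    with that G_step[of f g] show ?thesis
      by (auto simp: T_def distinct_map image_comp intro!: bexI[of _ "f \<circ> g"])
  qed
  have T_sub: "T \<subseteq> distinct_tuples m"
    by (auto simp: T_def G_def distinct_tuples_def tuples_def dest: distinct_card)
  have "finite (tuples m :: 'v list set)"
    using finite_lists_length_eq[of "UNIV :: 'v set" m] by (simp add: tuples_def)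
  then have T_fin: "finite T"
    by (rule finite_subset[rotated]) (use T_sub in \<open>auto simp: distinct_tuples_def\<close>)
  have T_nonempty: "0 < length xs" if "xs \<in> T" for xs
    using that by (auto simp: T_def)
  have "set_pmf lam \<subseteq> (\<Union>g\<in>G. range g)"
  proof -
    obtain g where "g \<in> generated_semigroup \<mu>" "g \<in> G"
      by (rule obtain_min_rank[of \<mu>]) (auto simp: G_def m_def)
    moreover have "f x \<in> (\<Union>g\<in>G. range g)"
      if f: "f \<in> set_pmf \<mu>" and x: "x \<in> (\<Union>g\<in>G. range g)" for f x
    proof -
      obtain g y where "g \<in> G" "x = g y" using x by blast
      with G_step(1)[OF f, of g] show ?thesis by (auto intro!: bexI[of _ "f \<circ> g"])
    qed
    ultimately show ?thesis
      by (intro invariant_pmf_support_subset[OF assms]) auto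
  qed
  moreover have "\<exists>xs\<in>T. xs ! 0 = v" if v: "v \<in> (\<Union>g\<in>G. range g)" for v
  proof -
    obtain g where g: "g \<in> G" "v \<in> range g" using v by blast
    obtain ys where "set ys = range g - {v}" "distinct ys"
      using finite_distinct_list[of "range g - {v}"] by auto
    then have "v # ys \<in> T" using g by (auto simp: T_def)
    then show ?thesis by force
  qed
  \<comment> \<open>\<open>t\<close> picks a tuple starting with the given point, so
    \<open>map_pmf t lam\<close> lives on \<open>T\<close> and has first marginal
    \<open>lam\<close>.\<close>
  ultimately obtain t where t: "\<And>v. v \<in> set_pmf lam \<Longrightarrow> t v \<in> T \<and> t v ! 0 = v"
    by (metis subsetD)
  define q where "q n = (conv_tuples \<mu> ^^ n) (map_pmf t lam)" for n
  have q_Suc: "q (Suc n) = conv_tuples \<mu> (q n)" for n by (simp add: q_def)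
  have q_T: "set_pmf (q n) \<subseteq> T" for n
    by (induction n) (use t T_step in \<open>force simp: q_def conv_tuples_def\<close>)+
  \<comment> \<open>Taking the first marginal turns \<open>conv_tuples\<close> into
    \<open>conv\<close>, which fixes \<open>lam\<close>.\<close>
  have q_marginal: "map_pmf (\<lambda>xs. xs ! 0) (q n) = lam" for n
  proof (induction n)
    case 0
    have "map_pmf (\<lambda>v. t v ! 0) lam = map_pmf id lam"
      by (intro pmf.map_cong) (auto simp: t)
    then show ?case by (simp add: q_def pmf.map_comp o_def)
  next
    case (Suc n)
    have "map_pmf (\<lambda>xs. xs ! 0) (q (Suc n)) = conv \<mu> lam"
      unfolding q_Suc using q_T T_nonempty by (subst marginal_conv_tuples) (auto simp: Suc)
    with assms show ?case by simp
  qed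
  obtain \<Lambda> where \<Lambda>: "set_pmf \<Lambda> \<subseteq> T" "\<Lambda> = conv_tuples \<mu> \<Lambda>"
    "\<And>A c. (\<And>n. measure_pmf.prob (q n) A = c) \<Longrightarrow> measure_pmf.prob \<Lambda> A = c"
    by (rule cesaro_limit_pmf[of T q, OF T_fin q_T q_Suc[unfolded conv_tuples_eq_bind],
          folded conv_tuples_eq_bind]) (rule that, assumption+, blast)
  have "measure_pmf.prob \<Lambda> {xs \<in> distinct_tuples m. xs ! 0 = v} = pmf lam v" for v
  proof (rule \<Lambda>(3))
    fix n
    \<comment> \<open>The two events agree on \<open>T\<close>, which carries \<open>q n\<close>;
      the second is read off from the marginal, so the value is the same for all
      \<open>n\<close>.\<close>
    have "measure_pmf.prob (q n) {xs \<in> distinct_tuples m. xs ! 0 = v}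
        = measure_pmf.prob (q n) ((\<lambda>xs. xs ! 0) -` {v})"
      using q_T T_sub
      by (intro measure_pmf.finite_measure_eq_AE) (auto simp: AE_measure_pmf_iff)
    also have "\<dots> = pmf (map_pmf (\<lambda>xs. xs ! 0) (q n)) v"
      by (simp add: pmf_map)
    finally show "measure_pmf.prob (q n) {xs \<in> distinct_tuples m. xs ! 0 = v} = pmf lam v"
      by (simp add: q_marginal)
  qed
  moreover have "\<Lambda> \<in> prob_measures_on (distinct_tuples m)"
    using \<Lambda>(1) T_sub by (auto simp: prob_measures_on_def)
  ultimately show ?thesis
    unfolding m_def
    by (intro bexI[of _ \<Lambda>] conjI allI \<Lambda>(2))
qed

end
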